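(* For every fixed $0<\delta<1$, \[ \delta^{-1}\le\liminf_{d\to\infty}N_{[]}(d,\delta)^{1/d}\le\limsup_{d\to\infty}N_{[]}(d,\delta)^{1/d}\le F(A_\delta), \] and, as $\delta\downarrow0$, $F(A_\delta)=\delta^{-1}+e+O(\delta)$.
   Context: For $\boldsymbol x=(x_1,\dots,x_d)\in[0,1]^d$ put $V(\boldsymbol x)=\prod_{j=1}^d x_j$; $\boldsymbol x\le\boldsymbol y$ means $x_j\le y_j$ for all $j$. If $\boldsymbol x\le\boldsymbol y$ in $[0,1]^d$, the box $[\boldsymbol x,\boldsymbol y]=\prod_{j=1}^d[x_j,y_j]$ is a $\delta$-bracket when $V(\boldsymbol y)-V(\boldsymbol x)\le\delta$. A $\delta$-bracketing cover is a finite family of $\delta$-brackets whose union is $[0,1]^d$; $N_{[]}(d,\delta)$ is its minimum possible cardinality. Moreover \[ A_\delta:=\sup_{L\ge0}\frac{L}{\log(1+\delta e^L)},\qquad F(t):=\frac{(1+t)^{1+t}}{t^t}\ (t>0),\qquad F(0):=1 . \] *)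

theory Defs
  imports "HOL-Analysis.Analysis" "HOL-Library.Landau_Symbols"
begin

text \<open>
  The dimension \<open>d\<close> varies inside the statement, so points of \<open>[0,1]\<^sup>d\<close> are extensional
  functions on the index set \<open>{..<d}\<close>.
\<close>

definition unit_cube :: "nat \<Rightarrow> (nat \<Rightarrow> real) set" where
  "unit_cube d = ({..<d} \<rightarrow>\<^sub>E {0..1})"

definition volume :: "nat \<Rightarrow> (nat \<Rightarrow> real) \<Rightarrow> real" where
  "volume d x = (\<Prod>j<d. x j)"

definition cube_le :: "nat \<Rightarrow> (nat \<Rightarrow> real) \<Rightarrow> (nat \<Rightarrow> real) \<Rightarrow> bool" where
  "cube_le d x y \<longleftrightarrow> (\<forall>j<d. x j \<le> y j)"

definition closed_box :: "nat \<Rightarrow> (nat \<Rightarrow> real) \<Rightarrow> (nat \<Rightarrow> real) \<Rightarrow> (nat \<Rightarrow> real) set" where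
  "closed_box d x y = (\<Pi>\<^sub>E j\<in>{..<d}. {x j..y j})"

definition is_bracket :: "nat \<Rightarrow> real \<Rightarrow> (nat \<Rightarrow> real) set \<Rightarrow> bool" where
  "is_bracket d \<delta> B \<longleftrightarrow>
     (\<exists>x\<in>unit_cube d. \<exists>y\<in>unit_cube d.
        cube_le d x y \<and> volume d y - volume d x \<le> \<delta> \<and> B = closed_box d x y)"

definition is_bracketing_cover :: "nat \<Rightarrow> real \<Rightarrow> (nat \<Rightarrow> real) set set \<Rightarrow> bool" where
  "is_bracketing_cover d \<delta> \<B> \<longleftrightarrow>
     finite \<B> \<and> (\<forall>B\<in>\<B>. is_bracket d \<delta> B) \<and> \<Union>\<B> = unit_cube d"

definition bracketing_number :: "nat \<Rightarrow> real \<Rightarrow> nat" where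
  "bracketing_number d \<delta> = (LEAST n. \<exists>\<B>. is_bracketing_cover d \<delta> \<B> \<and> card \<B> = n)"

definition A_const :: "real \<Rightarrow> real" where
  "A_const \<delta> = (SUP L\<in>{0..}. L / ln (1 + \<delta> * exp L))"

definition F_fun :: "real \<Rightarrow> real" where
  "F_fun t = (if t = 0 then 1 else (1 + t) powr (1 + t) / t powr t)"

text \<open>
  The two lemmas below show that the minimum in \<^const>\<open>bracketing_number\<close> and the real supremum
  in \<^const>\<open>A_const\<close> are genuine, i.e. taken over a nonempty, respectively bounded, set.
\<close>

lemma ex_bracketing_cover:
  assumes "0 < \<delta>"
  shows "\<exists>\<B>. is_bracketing_cover d \<delta> \<B>"
proof -
  obtain m :: nat where m: "real d / \<delta> < real m" and m0: "m > 0"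
    by (metis reals_Archimedean2 less_trans of_nat_0_less_iff gr0I not_less_zero assms
        divide_nonneg_pos le_less_trans of_nat_0_le_iff)
  define lo where "lo k = (\<lambda>j\<in>{..<d}. real (k j) / real m)" for k :: "nat \<Rightarrow> nat"
  define hi where "hi k = (\<lambda>j\<in>{..<d}. (real (k j) + 1) / real m)" for k :: "nat \<Rightarrow> nat"
  define K where "K = ({..<d} \<rightarrow>\<^sub>E {..<m})"
  define \<B> where "\<B> = (\<lambda>k. closed_box d (lo k) (hi k)) ` K"
  have K_less: "real (k j) + 1 \<le> real m" if "k \<in> K" "j < d" for k j
  proof -
    have "k j < m" using that by (auto simp: K_def)
    then show ?thesis by linarith
  qed
  have lo: "lo k \<in> unit_cube d" and hi: "hi k \<in> unit_cube d" if "k \<in> K" for k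
    using K_less[OF that] m0 by (force simp: lo_def hi_def unit_cube_def divide_simps)+
  have le: "cube_le d (lo k) (hi k)" for k
    using m0 by (simp add: cube_le_def lo_def hi_def divide_simps)
  have vol: "volume d (hi k) - volume d (lo k) \<le> \<delta>" if "k \<in> K" for k
  proof -
    have "norm ((\<Prod>j<d. hi k j) - (\<Prod>j<d. lo k j)) \<le> (\<Sum>j<d. norm (hi k j - lo k j))"
      using lo[OF that] hi[OF that]
      by (intro norm_prod_diff) (force simp: unit_cube_def PiE_iff)+
    also have "\<dots> = (\<Sum>j<d. 1 / real m)"
      by (intro sum.cong) (auto simp: hi_def lo_def diff_divide_distrib[symmetric])
    also have "\<dots> = real d / real m" by simp
    also have "\<dots> \<le> \<delta>" using m m0 assms by (simp add: divide_simps mult.commute)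
    finally show ?thesis by (simp add: volume_def)
  qed
  have "is_bracket d \<delta> B" if "B \<in> \<B>" for B
    using that lo hi le vol unfolding \<B>_def is_bracket_def by blast
  moreover have "finite \<B>"
    by (auto simp: \<B>_def K_def intro!: finite_imageI finite_PiE)
  moreover have "\<Union>\<B> = unit_cube d"
  proof (intro equalityI subsetI)
    fix z assume "z \<in> \<Union>\<B>"
    then obtain k where k: "k \<in> K" "z \<in> closed_box d (lo k) (hi k)" by (auto simp: \<B>_def)
    have "z j \<in> {0..1}" if "j < d" for j
    proof -
      have "0 \<le> lo k j" "hi k j \<le> 1" "lo k j \<le> z j" "z j \<le> hi k j"
        using lo[OF k(1)] hi[OF k(1)] k(2) that by (auto simp: unit_cube_def closed_box_def PiE_iff)
      then show ?thesis by simp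
    qed
    then show "z \<in> unit_cube d"
      using k(2) by (auto simp: unit_cube_def closed_box_def PiE_iff)
  next
    fix z assume z: "z \<in> unit_cube d"
    have "\<exists>i<m. real i / real m \<le> z j \<and> z j \<le> (real i + 1) / real m" if "j < d" for j
    proof -
      have z01: "0 \<le> z j" "z j \<le> 1" using z that by (auto simp: unit_cube_def PiE_iff)
      show ?thesis
      proof (cases "z j = 1")
        case True
        then show ?thesis using m0 by (intro exI[of _ "m - 1"]) (auto simp: of_nat_diff)
      next
        case False
        define i where "i = nat \<lfloor>real m * z j\<rfloor>"
        have "real m * z j < real m" using False z01 m0 by simp
        moreover have "real i \<le> real m * z j" "real m * z j \<le> real i + 1"
          using z01 by (auto simp: i_def)
        moreover from calculation have "i < m" by linarith
        ultimately show ?thesis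
          using m0 by (intro exI[of _ i]) (auto simp: divide_simps mult.commute)
      qed
    qed
    then obtain k where k: "\<And>j. j < d \<Longrightarrow>
        k j < m \<and> real (k j) / real m \<le> z j \<and> z j \<le> (real (k j) + 1) / real m"
      by metis
    have "restrict k {..<d} \<in> K" using k by (auto simp: K_def)
    moreover have "z \<in> closed_box d (lo (restrict k {..<d})) (hi (restrict k {..<d}))"
      using k z by (auto simp: closed_box_def lo_def hi_def unit_cube_def PiE_iff)
    ultimately show "z \<in> \<Union>\<B>" by (auto simp: \<B>_def)
  qed
  ultimately show ?thesis unfolding is_bracketing_cover_def by blast
qed

lemma bdd_above_A_const:
  fixes \<delta> :: real
  assumes "0 < \<delta>" "\<delta> < 1"
  shows "bdd_above ((\<lambda>L. L / ln (1 + \<delta> * exp L)) ` {0..})"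
proof (rule bdd_aboveI2)
  fix L :: real assume L: "L \<in> {0..}"
  have "exp ((1 - \<delta>) *\<^sub>R 0 + \<delta> *\<^sub>R L) \<le> (1 - \<delta>) * exp 0 + \<delta> * exp L"
    by (rule convex_onD[OF exp_convex]) (use assms in auto)
  also have "\<dots> \<le> 1 + \<delta> * exp L" using assms by simp
  finally have "exp (\<delta> * L) \<le> 1 + \<delta> * exp L" by simp
  then have le: "\<delta> * L \<le> ln (1 + \<delta> * exp L)"
    using assms by (subst ln_ge_iff) (auto intro: add_pos_pos)
  have "0 < ln (1 + \<delta> * exp L)" using assms by (intro ln_gt_zero) simp
  then show "L / ln (1 + \<delta> * exp L) \<le> 1 / \<delta>"
    using le assms by (simp add: divide_simps mult.commute)
qed

end

theory Submission
  imports Defs "HOL-Real_Asymp.Real_Asymp"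
begin

text \<open>
  Lower bound. Under the coordinatewise map \<open>x \<mapsto> x\<^sup>d\<close> the function \<open>V\<close> becomes the geometric
  mean of the coordinates. The geometric mean is superadditive, so the image of a
  \<open>\<delta>\<close>-bracket has side lengths whose geometric mean is at most \<open>\<delta>\<close>, that is, Lebesgue measure
  at most \<open>\<delta>\<^sup>d\<close> (lemma \<open>prod_diff_le_power\<close>). The map sends the cube onto itself, so
  \<open>N(d, \<delta>) \<ge> \<delta>\<^sup>-\<^sup>d\<close> for every \<open>d > 0\<close>.

  Upper bound. In the coordinates \<open>s = - ln x\<close> the volume is \<open>exp (- (\<Sum>j. s j))\<close>, and a grid cell
  of side \<open>h\<close> that reaches total height at least \<open>L\<close> is a bracket as soon as
  \<open>h * d \<le> ln (1 + \<delta> * exp L)\<close> (lemma \<open>log_cell_is_bracket\<close>): the farther from the corner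
  \<open>(1,\<dots>,1)\<close>, the coarser the grid may be. The range of total heights up to \<open>2 * ln (1 / \<delta>)\<close> is
  therefore cut into finitely many thin layers, their number independent of \<open>d\<close>, and each layer
  gets its own grid. A grid cell meeting the layer at height \<open>L\<close> has an index vector whose entries
  sum to at most about \<open>d * L / ln (1 + \<delta> * exp L)\<close>, which is at most \<open>d * A\<close> by the definition of
  \<open>A = A_const \<delta>\<close>. Points of height above \<open>2 * ln (1 / \<delta>)\<close> are covered by brackets with lower corner
  \<open>0\<close>, whose index vectors have entries summing to exactly \<open>d\<close>; this is within the same budget
  because \<open>A \<ge> 1\<close>. There are at most \<open>F t ^ d\<close> index vectors of sum at most \<open>t * d\<close>, by the
  exponential-moment bound \<open>card_lattice_simplex_le\<close>, and the factor counting the layers disappears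
  in the \<open>d\<close>-th root. Thin layers cost an \<open>\<epsilon>\<close> in the argument of \<open>F\<close>, removed by continuity.

  Asymptotics. With \<open>y = e * \<delta>\<close>, the value at \<open>L = 1\<close> gives \<open>A \<ge> 1 / ln (1 + y)\<close>, and
  lemma \<open>level_ratio_le\<close> gives \<open>A \<le> 1 / y + 1 / 2 + y\<close>, so \<open>A = 1 / y + 1 / 2 + O(\<delta>)\<close>. Since
  \<open>F t = e * (t + 1 / 2) + O(1 / t)\<close> at infinity, \<open>F A = 1 / \<delta> + e + O(\<delta>)\<close>.
\<close>

section \<open>The geometric mean and the lower bound\<close>

lemma powr_inverse_power:
  assumes "d > 0" "0 \<le> (u::real)"
  shows "(u powr (1 / real d)) ^ d = u"
  using assms by (cases "u = 0") (simp_all add: powr_powr flip: powr_realpow)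

lemma power_powr_inverse:
  assumes "d > 0" "0 \<le> (u::real)"
  shows "(u ^ d) powr (1 / real d) = u"
proof (cases "u = 0")
  case False
  then have "u ^ d = u powr real d" using assms by (simp add: powr_realpow)
  then show ?thesis using assms by (simp add: powr_powr)
qed (use assms in \<open>simp add: zero_power\<close>)

text \<open>
  Superadditivity of the geometric mean \<open>G\<close>, for \<open>Y = y\<^sup>d\<close> and \<open>X = x\<^sup>d\<close>: dividing by \<open>G Y\<close>, the
  inequality \<open>G X + G (Y - X) \<le> G Y\<close> follows from the arithmetic-geometric mean inequality applied
  to the ratios \<open>X / Y\<close> and \<open>1 - X / Y\<close>, whose arithmetic means add up to \<open>1\<close>.
\<close>
lemma prod_diff_le_power:
  fixes x y :: "nat \<Rightarrow> real"
  assumes d: "d > 0"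
    and xy: "\<And>j. j < d \<Longrightarrow> 0 \<le> x j \<and> x j \<le> y j"
    and V: "(\<Prod>j<d. y j) - (\<Prod>j<d. x j) \<le> \<delta>"
  shows "(\<Prod>j<d. y j ^ d - x j ^ d) \<le> \<delta> ^ d"
proof (cases "\<exists>j<d. y j = 0")
  case True
  then obtain j where j: "j < d" "y j = 0" by blast
  then have "x j = 0" using xy[of j] by simp
  then have 0: "(\<Prod>j<d. y j ^ d - x j ^ d) = 0"
    using j by (intro prod_zero bexI[of _ j]) auto
  have "(\<Prod>j<d. x j) \<le> (\<Prod>j<d. y j)"
    using xy by (intro prod_mono) auto
  then have "0 \<le> \<delta>" using V by linarith
  then show ?thesis unfolding 0 by simp
next
  case False
  then have ypos: "0 < y j" if "j < d" for j
    using xy[OF that] that by (metis less_eq_real_def order.trans)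
  define r where "r j = x j / y j" for j
  have r: "0 \<le> r j" "r j \<le> 1" if "j < d" for j
    using xy[OF that] ypos[OF that] by (auto simp: r_def divide_simps)
  define P where "P = (\<Prod>j<d. y j)"
  have P: "P > 0" unfolding P_def using ypos by (intro prod_pos) auto
  have amgm: "(\<Prod>j<d. u j) powr (1 / real d) \<le> (\<Sum>j<d. u j) / real d"
    if "\<And>j. j < d \<Longrightarrow> 0 \<le> u j" for u :: "nat \<Rightarrow> real"
    using arith_geom_mean[of "{..<d}" u] that d by (simp add: sum_divide_distrib lessThan_empty_iff)
  have "(\<Prod>j<d. r j ^ d) powr (1 / real d) + (\<Prod>j<d. 1 - r j ^ d) powr (1 / real d)
      \<le> (\<Sum>j<d. r j ^ d) / real d + (\<Sum>j<d. 1 - r j ^ d) / real d"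
    using r by (intro add_mono amgm) (auto intro: power_le_one)
  also have "\<dots> = 1"
    using d by (simp add: sum_subtractf add_divide_distrib[symmetric])
  finally have *: "(\<Prod>j<d. r j ^ d) powr (1 / real d) + (\<Prod>j<d. 1 - r j ^ d) powr (1 / real d) \<le> 1" .
  have r_prod: "(\<Prod>j<d. r j ^ d) powr (1 / real d) = (\<Prod>j<d. r j)"
    using power_powr_inverse[OF d, of "\<Prod>j<d. r j"] r
    by (subst prod_power_distrib[symmetric]) (auto intro: prod_nonneg)
  have x_prod: "(\<Prod>j<d. x j) = P * (\<Prod>j<d. r j)"
  proof -
    have "P * (\<Prod>j<d. r j) = (\<Prod>j<d. y j * r j)" by (simp add: P_def prod.distrib)
    also have "\<dots> = (\<Prod>j<d. x j)"
    proof (rule prod.cong[OF refl])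
      fix j assume "j \<in> {..<d}"
      then show "y j * r j = x j" using ypos[of j] by (simp add: r_def)
    qed
    finally show ?thesis ..
  qed
  define G where "G = (\<Prod>j<d. 1 - r j ^ d) powr (1 / real d)"
  have "P * ((\<Prod>j<d. r j) + G) \<le> P * 1"
    using * P unfolding r_prod G_def by (intro mult_left_mono) auto
  then have PG: "P * G \<le> \<delta>"
    using V by (simp add: x_prod P_def[symmetric] distrib_left)
  have Q0: "0 \<le> (\<Prod>j<d. 1 - r j ^ d)" using r by (intro prod_nonneg) (auto intro: power_le_one)
  have Gd: "G ^ d = (\<Prod>j<d. 1 - r j ^ d)"
    unfolding G_def by (rule powr_inverse_power[OF d Q0])
  have "(\<Prod>j<d. y j ^ d - x j ^ d) = (\<Prod>j<d. y j ^ d * (1 - r j ^ d))"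
  proof (rule prod.cong[OF refl])
    fix j assume "j \<in> {..<d}"
    then show "y j ^ d - x j ^ d = y j ^ d * (1 - r j ^ d)"
      using ypos[of j] by (simp add: r_def power_divide right_diff_distrib)
  qed
  also have "\<dots> = (P * G) ^ d"
    by (simp add: prod.distrib Gd P_def power_mult_distrib prod_power_distrib[symmetric])
  also have "\<dots> \<le> \<delta> ^ d"
    using PG P by (intro power_mono) (auto simp: G_def)
  finally show ?thesis .
qed

lemma bracketing_number_lower:
  assumes \<delta>: "0 < \<delta>" and d: "d > 0"
  shows "(1 / \<delta>) ^ d \<le> real (bracketing_number d \<delta>)"
proof -
  obtain \<B> where cov: "is_bracketing_cover d \<delta> \<B>" and card: "card \<B> = bracketing_number d \<delta>"
    using LeastI_ex[of "\<lambda>n. \<exists>\<B>. is_bracketing_cover d \<delta> \<B> \<and> card \<B> = n"] ex_bracketing_cover[OF \<delta>]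
    unfolding bracketing_number_def by blast
  have fin: "finite \<B>" and un: "\<Union>\<B> = unit_cube d"
    and br: "\<And>B. B \<in> \<B> \<Longrightarrow> is_bracket d \<delta> B"
    using cov by (auto simp: is_bracketing_cover_def)
  obtain X Y where XY: "\<And>B. B \<in> \<B> \<Longrightarrow> X B \<in> unit_cube d \<and> Y B \<in> unit_cube d \<and> cube_le d (X B) (Y B)
      \<and> volume d (Y B) - volume d (X B) \<le> \<delta> \<and> B = closed_box d (X B) (Y B)"
    using br unfolding is_bracket_def by metis
  interpret product_sigma_finite "\<lambda>_::nat. lborel :: real measure"
    by unfold_locales
  define M where "M = Pi\<^sub>M {..<d} (\<lambda>_::nat. lborel :: real measure)"
  \<comment> \<open>image of the bracket \<open>B\<close> under the coordinatewise \<open>d\<close>-th power\<close>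
  define C where "C B = closed_box d (\<lambda>j. X B j ^ d) (\<lambda>j. Y B j ^ d)" for B
  have meas: "closed_box d u v \<in> sets M" for u v
    unfolding closed_box_def M_def by (intro sets_PiM_I_finite) auto
  have em: "emeasure M (closed_box d u v) = ennreal (\<Prod>j<d. v j - u j)"
    if "\<And>j. j < d \<Longrightarrow> u j \<le> v j" for u v
  proof -
    have "emeasure M (closed_box d u v) = (\<Prod>j<d. emeasure lborel {u j..v j})"
      unfolding closed_box_def M_def by (rule emeasure_PiM) auto
    also have "\<dots> = (\<Prod>j<d. ennreal (v j - u j))"
      using that by (intro prod.cong) auto
    also have "\<dots> = ennreal (\<Prod>j<d. v j - u j)"
      using that by (intro prod_ennreal) auto
    finally show ?thesis .
  qed
  have bounds: "0 \<le> X B j \<and> X B j \<le> Y B j" if "B \<in> \<B>" "j < d" for B j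
    using XY[OF that(1)] that(2) by (auto simp: unit_cube_def cube_le_def PiE_iff)
  have small: "emeasure M (C B) \<le> ennreal (\<delta> ^ d)" if B: "B \<in> \<B>" for B
  proof -
    have "emeasure M (C B) = ennreal (\<Prod>j<d. Y B j ^ d - X B j ^ d)"
      unfolding C_def using bounds[OF B] by (intro em power_mono) auto
    also have "\<dots> \<le> ennreal (\<delta> ^ d)"
      using XY[OF B] bounds[OF B] d
      by (intro ennreal_leI prod_diff_le_power) (auto simp: volume_def)
    finally show ?thesis .
  qed
  have cube: "closed_box d (\<lambda>_. 0) (\<lambda>_. 1) \<subseteq> (\<Union>B\<in>\<B>. C B)"
  proof
    fix z assume z: "z \<in> closed_box d (\<lambda>_. 0) (\<lambda>_. 1)"
    define w where "w = (\<lambda>j\<in>{..<d}. root d (z j))"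
    have zj: "0 \<le> z j" "z j \<le> 1" if "j < d" for j
      using z that by (auto simp: closed_box_def PiE_iff)
    have "w \<in> unit_cube d"
      using zj d by (auto simp: w_def unit_cube_def real_root_ge_zero)
    then obtain B where B: "B \<in> \<B>" "w \<in> B" using un by blast
    have w_box: "w \<in> closed_box d (X B) (Y B)" using B XY by auto
    have wj: "X B j \<le> w j" "w j \<le> Y B j" if "j < d" for j
      using w_box that by (auto simp: closed_box_def PiE_iff)
    have "z \<in> C B"
      unfolding C_def closed_box_def
    proof (rule PiE_I)
      fix j assume j: "j \<in> {..<d}"
      then have "w j ^ d = z j" using zj d by (simp add: w_def)
      then show "z j \<in> {X B j ^ d..Y B j ^ d}"
        using wj[of j] bounds[OF B(1), of j] j
        by (metis atLeastAtMost_iff lessThan_iff order_trans power_mono)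
    qed (use z in \<open>auto simp: closed_box_def PiE_iff extensional_def\<close>)
    then show "z \<in> (\<Union>B\<in>\<B>. C B)" using B by blast
  qed
  have "1 = emeasure M (closed_box d (\<lambda>_. 0) (\<lambda>_. 1))"
    by (subst em) auto
  also have "\<dots> \<le> emeasure M (\<Union>B\<in>\<B>. C B)"
    using cube fin meas by (intro emeasure_mono sets.finite_UN) (auto simp: C_def)
  also have "\<dots> \<le> (\<Sum>B\<in>\<B>. emeasure M (C B))"
    using fin meas by (intro emeasure_subadditive_finite) (auto simp: C_def)
  also have "\<dots> \<le> (\<Sum>B\<in>\<B>. ennreal (\<delta> ^ d))"
    by (intro sum_mono small)
  also have "\<dots> = ennreal (real (card \<B>) * \<delta> ^ d)"
    using \<delta> by (simp add: ennreal_mult'' ennreal_of_nat_eq_real_of_nat)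
  finally have "1 \<le> real (card \<B>) * \<delta> ^ d"
    by (simp add: ennreal_le_iff2 flip: ennreal_1)
  then show ?thesis using \<delta> by (simp add: card power_one_over divide_simps)
qed

lemma liminf_bracketing_number_ge:
  assumes "0 < \<delta>"
  shows "ereal (1 / \<delta>) \<le> liminf (\<lambda>d. ereal (real (bracketing_number d \<delta>) powr (1 / real d)))"
proof (rule Liminf_bounded, rule eventually_mono[OF eventually_gt_at_top[of 0]])
  fix d :: nat assume d: "d > 0"
  have "1 / \<delta> = ((1 / \<delta>) ^ d) powr (1 / real d)"
    using power_powr_inverse[OF d, of "1 / \<delta>"] assms by simp
  also have "\<dots> \<le> real (bracketing_number d \<delta>) powr (1 / real d)"
    using assms by (intro powr_mono2 bracketing_number_lower d) auto
  finally show "ereal (1 / \<delta>) \<le> ereal (real (bracketing_number d \<delta>) powr (1 / real d))" by simp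
qed

section \<open>Counting lattice points in a simplex\<close>

definition lattice_simplex :: "nat \<Rightarrow> real \<Rightarrow> (nat \<Rightarrow> nat) set" where
  "lattice_simplex d t = {k \<in> {..<d} \<rightarrow>\<^sub>E UNIV. real (\<Sum>j<d. k j) \<le> t * real d}"

lemma F_fun_eq:
  assumes "t > 0"
  shows "F_fun t = (1 + t) * exp (t * ln (1 + 1 / t))"
proof -
  have "ln (1 + 1 / t) = ln (1 + t) - ln t"
    using assms ln_div[of "1 + t" t] by (simp add: add_divide_distrib add.commute)
  then show ?thesis
    using assms by (simp add: F_fun_def powr_def distrib_right exp_add exp_diff right_diff_distrib)
qed

lemma lattice_simplex_subset:
  "lattice_simplex d t \<subseteq> {..<d} \<rightarrow>\<^sub>E {..nat \<lfloor>t * real d\<rfloor>}"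
proof
  fix k assume k: "k \<in> lattice_simplex d t"
  have "k j \<le> nat \<lfloor>t * real d\<rfloor>" if "j < d" for j
  proof -
    have "k j \<le> (\<Sum>j<d. k j)" using that by (intro member_le_sum) auto
    also have "\<dots> \<le> nat \<lfloor>t * real d\<rfloor>" 
      using k by (simp add: lattice_simplex_def le_nat_iff le_floor_iff del: of_nat_sum)
    finally show ?thesis .
  qed
  then show "k \<in> {..<d} \<rightarrow>\<^sub>E {..nat \<lfloor>t * real d\<rfloor>}"
    using k by (auto simp: lattice_simplex_def PiE_iff)
qed

lemma finite_lattice_simplex: "finite (lattice_simplex d t)"
  using lattice_simplex_subset by (rule finite_subset) (auto intro: finite_PiE)

text \<open>
  Weight the index vector \<open>k\<close> by \<open>q ^ (\<Sum>j. k j)\<close> with \<open>0 < q < 1\<close>. The total weight over all vectors is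
  \<open>(1 / (1 - q)) ^ d\<close>, and each vector of the simplex has weight at least \<open>q powr (t * d)\<close>. The
  quotient of the two is smallest at \<open>q = t / (1 + t)\<close>, where it equals \<open>F t ^ d\<close>.
\<close>
lemma card_lattice_simplex_le:
  assumes t: "t > 0"
  shows "real (card (lattice_simplex d t)) \<le> F_fun t ^ d"
proof -
  define q where "q = t / (1 + t)"
  have q: "0 < q" "q < 1" using t by (auto simp: q_def)
  have lnq: "ln q = - ln (1 + 1 / t)"
    using t by (simp add: q_def ln_div[symmetric] ln_inverse[symmetric] field_simps)
  define N where "N = nat \<lfloor>t * real d\<rfloor>"
  have "real (card (lattice_simplex d t)) * q powr (t * real d)
      = (\<Sum>k\<in>lattice_simplex d t. q powr (t * real d))" by simp
  also have "\<dots> \<le> (\<Sum>k\<in>lattice_simplex d t. \<Prod>j<d. q ^ k j)"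
  proof (rule sum_mono)
    fix k assume "k \<in> lattice_simplex d t"
    then have "q powr (t * real d) \<le> q powr real (\<Sum>j<d. k j)"
      using q by (intro powr_mono') (auto simp: lattice_simplex_def)
    then show "q powr (t * real d) \<le> (\<Prod>j<d. q ^ k j)"
      using q by (simp only: powr_realpow power_sum)
  qed
  also have "\<dots> \<le> (\<Sum>k\<in>{..<d} \<rightarrow>\<^sub>E {..N}. \<Prod>j<d. q ^ k j)"
    using q lattice_simplex_subset[of d t] unfolding N_def
    by (intro sum_mono2 finite_PiE prod_nonneg) auto
  also have "\<dots> = (\<Prod>j<d. \<Sum>i\<in>{..N}. q ^ i)"
    by (subst prod_sum_PiE) auto
  also have "\<dots> \<le> (\<Prod>j<d. 1 + t)"
  proof (rule prod_mono, safe)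
    show "0 \<le> (\<Sum>i\<in>{..N}. q ^ i)" using q by (intro sum_nonneg) auto
    have "(\<Sum>i\<in>{..N}. q ^ i) \<le> (\<Sum>i. q ^ i)"
      using q by (intro sum_le_suminf summable_geometric) auto
    also have "\<dots> = 1 / (1 - q)" using q by (intro suminf_geometric) auto
    also have "\<dots> = 1 + t" using t by (simp add: q_def field_simps)
    finally show "(\<Sum>i\<in>{..N}. q ^ i) \<le> 1 + t" .
  qed
  also have "\<dots> = (1 + t) ^ d" by simp
  finally have "real (card (lattice_simplex d t)) * q powr (t * real d) \<le> (1 + t) ^ d" .
  moreover have "q powr (t * real d) = exp (- (t * ln (1 + 1 / t))) ^ d"
    using q by (simp add: powr_def lnq exp_of_nat_mult[symmetric] mult_ac)
  ultimately have "real (card (lattice_simplex d t)) * exp (- (t * ln (1 + 1 / t))) ^ d \<le> (1 + t) ^ d"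
    by simp
  then show ?thesis
    using t by (simp add: F_fun_eq exp_minus power_inverse power_mult_distrib divide_simps mult_ac)
qed

section \<open>The layered cover and the upper bound\<close>

lemma ex_le_with_sum:
  fixes n :: "'a \<Rightarrow> nat"
  assumes "finite S" "K \<le> sum n S"
  shows "\<exists>k. (\<forall>j\<in>S. k j \<le> n j) \<and> sum k S = K"
  using assms
proof (induction S arbitrary: K rule: finite_induct)
  case (insert a S)
  have "K - min K (n a) \<le> sum n S" using insert by auto
  then obtain k where k: "\<forall>j\<in>S. k j \<le> n j" "sum k S = K - min K (n a)"
    using insert.IH by blast
  have "sum (k(a := min K (n a))) S = sum k S"
    using insert.hyps by (intro sum.cong) auto
  then show ?case using k insert.hyps
    by (intro exI[of _ "k(a := min K (n a))"]) auto
qed auto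

lemma bracketing_number_le:
  assumes "finite \<B>" "\<And>B. B \<in> \<B> \<Longrightarrow> is_bracket d \<delta> B" "unit_cube d \<subseteq> \<Union>\<B>"
  shows "bracketing_number d \<delta> \<le> card \<B>"
proof -
  have "B \<subseteq> unit_cube d" if br: "is_bracket d \<delta> B" for B
  proof -
    obtain x y where x: "x \<in> unit_cube d" and y: "y \<in> unit_cube d" and B: "B = closed_box d x y"
      using br unfolding is_bracket_def by blast
    show ?thesis
      unfolding B unit_cube_def closed_box_def
    proof (rule PiE_mono)
      fix j assume "j \<in> {..<d}"
      then show "{x j..y j} \<subseteq> {0..1}" using x y by (auto simp: unit_cube_def PiE_iff)
    qed
  qed
  then have "is_bracketing_cover d \<delta> \<B>"
    using assms unfolding is_bracketing_cover_def by blast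
  then show ?thesis
    unfolding bracketing_number_def by (intro Least_le) blast
qed

text \<open>
  The grid is uniform in the scale \<open>s = - ln x\<close>, where volumes become sums. This scale reverses the
  order: increasing \<open>k\<close> moves the point towards \<open>0\<close>, so a cell has its upper corner at \<open>k\<close>.
\<close>
definition log_point :: "nat \<Rightarrow> real \<Rightarrow> (nat \<Rightarrow> nat) \<Rightarrow> nat \<Rightarrow> real" where
  "log_point d h k = (\<lambda>j\<in>{..<d}. exp (- (h * real (k j))))"

lemma log_point_in_cube: "h \<ge> 0 \<Longrightarrow> log_point d h k \<in> unit_cube d"
  by (auto simp: log_point_def unit_cube_def)

lemma volume_log_point: "volume d (log_point d h k) = exp (- (h * real (\<Sum>j<d. k j)))"
proof -
  have "volume d (log_point d h k) = (\<Prod>j<d. exp (- (h * real (k j))))"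
    by (simp add: volume_def log_point_def)
  also have "\<dots> = exp (\<Sum>j<d. - (h * real (k j)))" by (rule exp_sum[symmetric]) simp
  also have "(\<Sum>j<d. - (h * real (k j))) = - (h * real (\<Sum>j<d. k j))"
    by (simp add: sum_negf sum_distrib_left)
  finally show ?thesis .
qed

text \<open>
  If \<open>S\<close> is the total height of the lower corner, the volume difference of the cell is
  \<open>exp (- S) * (exp (h * d) - 1)\<close>. The condition is thus on the height of the far end of
  the cell, so it suffices that the cell contains some point of height at least \<open>c\<close>.
\<close>
lemma log_cell_is_bracket:
  assumes h: "h \<ge> 0" and c: "c \<le> h * (real (\<Sum>j<d. k j) + real d)"
    and e: "exp (h * real d) \<le> 1 + \<delta> * exp c" and \<delta>: "\<delta> \<ge> 0"
  shows "is_bracket d \<delta> (closed_box d (log_point d h (\<lambda>j. Suc (k j))) (log_point d h k))"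
proof -
  define S where "S = h * (real (\<Sum>j<d. k j) + real d)"
  have "volume d (log_point d h (\<lambda>j. Suc (k j))) = exp (- S)"
    by (simp add: volume_log_point S_def sum.distrib sum_Suc)
  moreover have "volume d (log_point d h k) = exp (- S) * exp (h * real d)"
    by (simp add: volume_log_point S_def exp_add[symmetric] algebra_simps)
  moreover have "exp (- S) * exp (h * real d) \<le> exp (- S) * (1 + \<delta> * exp c)"
    using e by simp
  moreover have "exp (- S) * (1 + \<delta> * exp c) = exp (- S) + \<delta> * exp (c - S)"
    by (simp add: exp_diff exp_minus field_simps)
  moreover have "\<delta> * exp (c - S) \<le> \<delta> * 1"
    using \<delta> c by (intro mult_left_mono) (auto simp: S_def)
  ultimately have "volume d (log_point d h k) - volume d (log_point d h (\<lambda>j. Suc (k j))) \<le> \<delta>"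
    by linarith
  moreover have "cube_le d (log_point d h (\<lambda>j. Suc (k j))) (log_point d h k)"
    using h by (auto simp: cube_le_def log_point_def intro!: mult_left_mono)
  ultimately show ?thesis
    unfolding is_bracket_def using log_point_in_cube[OF h] by blast
qed

text \<open>
  The layers are \<open>i * \<eta> \<le> \<Sum>j. s j < (i + 1) * \<eta>\<close> for \<open>i < m\<close>. The second hypothesis on \<open>t\<close> says that the
  index vectors of the cells meeting layer \<open>i\<close> lie in the lattice simplex with parameter \<open>t\<close>.
\<close>
lemma bracketing_number_upper:
  assumes \<delta>: "0 < \<delta>" "\<delta> < 1" and \<eta>: "\<eta> > 0" and m: "2 * ln (1 / \<delta>) \<le> real m * \<eta>"
    and t: "t \<ge> 1" "\<And>i. i < m \<Longrightarrow> (real i + 1) * \<eta> \<le> t * ln (1 + \<delta> * exp (real i * \<eta>))"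
    and d: "d > 0"
  shows "real (bracketing_number d \<delta>) \<le> (real m + 1) * F_fun t ^ d"
proof -
  define K where "K = lattice_simplex d t"
  define h where "h i = ln (1 + \<delta> * exp (real i * \<eta>)) / real d" for i :: nat
  define a where "a = ln (1 / \<delta>)"
  have a: "a > 0" using \<delta> by (simp add: a_def)
  have h: "h i > 0" for i using \<delta> d by (auto simp: h_def intro!: divide_pos_pos ln_gt_zero)
  have hd: "h i * real d = ln (1 + \<delta> * exp (real i * \<eta>))" for i using d by (simp add: h_def)
  define cell where "cell i k = closed_box d (log_point d (h i) (\<lambda>j. Suc (k j))) (log_point d (h i) k)"
    for i k
  define tail where "tail k = closed_box d (\<lambda>j\<in>{..<d}. 0) (log_point d (a / real d) k)" for k
  define U where "U = (\<Union>i<m. cell i ` K) \<union> tail ` K"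
  \<comment> \<open>A cell of grid \<open>i\<close> that misses layer \<open>i\<close> need not be a bracket; only the cells that are
    brackets are kept.\<close>
  define \<B> where "\<B> = {B \<in> U. is_bracket d \<delta> B}"
  have finK: "finite K" by (simp add: K_def finite_lattice_simplex)
  have finU: "finite U" unfolding U_def using finK by auto
  have "card U \<le> card (\<Union>i<m. cell i ` K) + card (tail ` K)"
    unfolding U_def by (rule card_Un_le)
  also have "\<dots> \<le> (\<Sum>i<m. card (cell i ` K)) + card (tail ` K)"
    by (intro add_mono card_UN_le) auto
  also have "\<dots> \<le> (\<Sum>i<m. card K) + card K"
    using finK by (intro add_mono sum_mono card_image_le)
  finally have cardU: "card U \<le> (m + 1) * card K" by simp
  have "unit_cube d \<subseteq> \<Union>\<B>"
  proof
    fix z assume z: "z \<in> unit_cube d"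
    have z01: "0 \<le> z j" "z j \<le> 1" if "j < d" for j
      using z that by (auto simp: unit_cube_def PiE_iff)
    have zext: "z \<in> extensional {..<d}" using z by (auto simp: unit_cube_def PiE_iff)
    define s where "s j = - ln (z j)" for j
    have s0: "0 \<le> s j" if "j < d" for j
      using z01[OF that] by (cases "z j = 0") (auto simp: s_def)
    have zs: "z j = exp (- s j)" if "j < d" "z j \<noteq> 0" for j
      using z01[OF that(1)] that by (simp add: s_def)
    have Vs: "volume d z = exp (- (\<Sum>j<d. s j))" if "\<And>j. j < d \<Longrightarrow> z j \<noteq> 0"
      unfolding volume_def using zs that by (simp add: exp_sum[symmetric] sum_negf)
    show "z \<in> \<Union>\<B>"
    proof (cases "volume d z > exp (- (2 * a))")
      case True
      have znz: "z j \<noteq> 0" if "j < d" for j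
      proof
        assume "z j = 0"
        then have "volume d z = 0" unfolding volume_def using that by (intro prod_zero) auto
        then show False using True by (simp add: not_less[symmetric])
      qed
      define \<Sigma> where "\<Sigma> = (\<Sum>j<d. s j)"
      have \<Sigma>: "0 \<le> \<Sigma>" "\<Sigma> < 2 * a"
        using True Vs[OF znz] s0 by (auto simp: \<Sigma>_def intro!: sum_nonneg)
      define i where "i = nat \<lfloor>\<Sigma> / \<eta>\<rfloor>"
      have i: "real i * \<eta> \<le> \<Sigma>" "\<Sigma> < (real i + 1) * \<eta>"
      proof -
        have "real i \<le> \<Sigma> / \<eta>" "\<Sigma> / \<eta> < real i + 1"
          using \<Sigma> \<eta> unfolding i_def by (simp_all add: of_nat_nat)
        then show "real i * \<eta> \<le> \<Sigma>" "\<Sigma> < (real i + 1) * \<eta>" using \<eta> by (simp_all add: field_simps)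
      qed
      have im: "i < m"
      proof -
        have "real i * \<eta> < real m * \<eta>" using i \<Sigma> m by (simp add: a_def)
        then show ?thesis using \<eta> by simp
      qed
      define k where "k = (\<lambda>j\<in>{..<d}. nat \<lfloor>s j / h i\<rfloor>)"
      have k: "h i * real (k j) \<le> s j" "s j \<le> h i * real (Suc (k j))" if "j < d" for j
      proof -
        have "real (k j) \<le> s j / h i" "s j / h i \<le> real (k j) + 1"
          using that s0[OF that] h[of i] unfolding k_def by (simp_all add: of_nat_nat)
        then show "h i * real (k j) \<le> s j" "s j \<le> h i * real (Suc (k j))"
          using h[of i] by (simp_all add: field_simps)
      qed
      have "h i * real (\<Sum>j<d. k j) = (\<Sum>j<d. h i * real (k j))" by (simp add: sum_distrib_left)
      also have "\<dots> \<le> \<Sigma>" unfolding \<Sigma>_def using k by (intro sum_mono) auto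
      also have "\<dots> \<le> h i * (t * real d)" using i t(2)[OF im] hd[of i] by (simp add: mult_ac)
      finally have "real (\<Sum>j<d. k j) \<le> t * real d" using h[of i] by (simp del: of_nat_sum)
      then have kK: "k \<in> K" by (simp add: K_def lattice_simplex_def k_def)
      note i(1)
      also have "\<Sigma> \<le> (\<Sum>j<d. h i * real (Suc (k j)))"
        unfolding \<Sigma>_def by (rule sum_mono, rule k(2)) simp
      also have "\<dots> = h i * (real (\<Sum>j<d. k j) + real d)"
        by (simp add: sum_distrib_left[symmetric] sum.distrib)
      finally have "is_bracket d \<delta> (cell i k)"
        unfolding cell_def using h[of i] \<delta> 
        by (intro log_cell_is_bracket[where c = "real i * \<eta>"]) (auto simp: hd add_pos_pos)
      moreover have "z \<in> cell i k"
        unfolding cell_def closed_box_def using k zs znz zext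
        by (auto simp: PiE_iff log_point_def)
      ultimately show ?thesis using im kK unfolding \<B>_def U_def by blast
    next
      case False
      \<comment> \<open>The height of a vanishing coordinate is infinite; one such coordinate alone
        must supply the required total of \<open>d\<close>.\<close>
      define n where "n j = (if z j = 0 then d else nat \<lfloor>s j / (a / real d)\<rfloor>)" for j
      have zn: "z j \<le> exp (- (a / real d * real (n j)))" if "j < d" for j
      proof (cases "z j = 0")
        case nz: False
        have "real (n j) \<le> s j / (a / real d)"
          using s0[OF that] nz a unfolding n_def by (simp add: of_nat_nat)
        then have "a / real d * real (n j) \<le> s j" using a d by (simp add: field_simps)
        then show ?thesis using zs[OF that nz] by simp
      qed auto
      have "d \<le> (\<Sum>j<d. n j)"
      proof (cases "\<exists>j<d. z j = 0")
        case True
        then obtain j where "j < d" "z j = 0" by blast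
        then have "d = n j" by (simp add: n_def)
        also have "\<dots> \<le> (\<Sum>j<d. n j)" using \<open>j < d\<close> by (intro member_le_sum) auto
        finally show ?thesis .
      next
        case nz: False
        have "volume d z = exp (- (\<Sum>j<d. s j))" using nz by (intro Vs) auto
        then have "2 * a \<le> (\<Sum>j<d. s j)" using False by (simp add: not_less)
        \<comment> \<open>Rounding down loses at most one unit per coordinate, hence the threshold \<open>2 * a\<close>.\<close>
        then have "2 * real d \<le> (\<Sum>j<d. s j) / (a / real d)"
          using a d by (simp add: field_simps)
        also have "\<dots> = (\<Sum>j<d. s j / (a / real d))" by (rule sum_divide_distrib)
        also have "\<dots> \<le> (\<Sum>j<d. real (n j) + 1)"
        proof (rule sum_mono)
          fix j assume "j \<in> {..<d}"
          then have "z j \<noteq> 0" using nz by auto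
          then show "s j / (a / real d) \<le> real (n j) + 1" unfolding n_def by simp linarith
        qed
        also have "\<dots> = real (\<Sum>j<d. n j) + real d" by (simp add: sum.distrib)
        finally show ?thesis by linarith
      qed
      then obtain k' where k': "\<forall>j\<in>{..<d}. k' j \<le> n j" "(\<Sum>j<d. k' j) = d"
        using ex_le_with_sum[of "{..<d}" d n] by auto
      define k where "k = restrict k' {..<d}"
      have k: "k j \<le> n j" if "j < d" for j using k' that by (simp add: k_def)
      have sumk: "(\<Sum>j<d. k j) = d" using k'(2) by (simp add: k_def)
      have "real (\<Sum>j<d. k j) \<le> t * real d" unfolding sumk using mult_right_mono[OF t(1), of "real d"] by simp
      then have kK: "k \<in> K" by (simp add: K_def lattice_simplex_def k_def)
      have zk: "z j \<le> exp (- (a / real d * real (k j)))" if "j < d" for j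
      proof -
        have "a / real d * real (k j) \<le> a / real d * real (n j)"
          using k[OF that] a by (intro mult_left_mono) auto
        then show ?thesis by (intro order_trans[OF zn[OF that]]) simp
      qed
      have "volume d (log_point d (a / real d) k) = \<delta>"
        using d \<delta> by (simp add: volume_log_point sumk a_def ln_div del: of_nat_sum)
      moreover have "volume d (\<lambda>j\<in>{..<d}. 0) = 0" using d by (simp add: volume_def)
      moreover have "(\<lambda>j\<in>{..<d}. 0) \<in> unit_cube d" by (auto simp: unit_cube_def)
      moreover have "cube_le d (\<lambda>j\<in>{..<d}. 0) (log_point d (a / real d) k)"
        by (simp add: cube_le_def log_point_def)
      moreover have "log_point d (a / real d) k \<in> unit_cube d"
        using a by (intro log_point_in_cube) auto
      ultimately have "is_bracket d \<delta> (tail k)"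
        unfolding is_bracket_def tail_def using \<delta>(1)
        by (intro bexI[of _ "log_point d (a / real d) k"] bexI[of _ "\<lambda>j\<in>{..<d}. 0"]) simp_all
      moreover have "z \<in> tail k"
        unfolding tail_def closed_box_def using zk z01 zext by (auto simp: PiE_iff log_point_def)
      ultimately show ?thesis using kK unfolding \<B>_def U_def by blast
    qed
  qed
  then have "bracketing_number d \<delta> \<le> card \<B>"
    using finU by (intro bracketing_number_le) (auto simp: \<B>_def)
  also have "\<dots> \<le> card U" using finU by (intro card_mono) (auto simp: \<B>_def)
  also note cardU
  finally have "bracketing_number d \<delta> \<le> (m + 1) * card K" .
  then have "real (bracketing_number d \<delta>) \<le> real ((m + 1) * card K)"
    by (simp only: of_nat_le_iff)
  also have "\<dots> = (real m + 1) * real (card K)" by (simp add: distrib_right)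
  also have "\<dots> \<le> (real m + 1) * F_fun t ^ d"
    unfolding K_def using t(1) by (intro mult_left_mono card_lattice_simplex_le) auto
  finally show ?thesis .
qed

lemma A_const_ge:
  assumes "0 < \<delta>" "\<delta> < 1" "0 \<le> L"
  shows "L / ln (1 + \<delta> * exp L) \<le> A_const \<delta>"
  unfolding A_const_def using assms by (intro cSUP_upper bdd_above_A_const) auto

text \<open>At \<open>L = - ln (1 - \<delta>)\<close> one has \<open>1 + \<delta> * exp L = exp L\<close>, so the quotient equals \<open>1\<close>.\<close>
lemma A_const_ge_1:
  assumes \<delta>: "0 < \<delta>" "\<delta> < 1"
  shows "1 \<le> A_const \<delta>"
proof -
  define L where "L = - ln (1 - \<delta>)"
  have L: "L > 0" using \<delta> by (simp add: L_def)
  have "1 + \<delta> * exp L = exp L"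
    using \<delta> by (simp add: L_def exp_minus field_simps)
  then have "L / ln (1 + \<delta> * exp L) = 1" using L by simp
  then show ?thesis using A_const_ge[OF \<delta>, of L] L by simp
qed

lemma continuous_F_fun:
  assumes "t > 0"
  shows "isCont F_fun t"
proof -
  have "isCont (\<lambda>t. (1 + t) * exp (t * ln (1 + 1 / t))) t"
    using assms by (intro continuous_intros) (auto simp: add_pos_pos less_imp_neq[symmetric])
  moreover have "eventually (\<lambda>t. F_fun t = (1 + t) * exp (t * ln (1 + 1 / t))) (nhds t)"
    using eventually_nhds_in_open[of "{0<..}" t] assms
    by (auto elim!: eventually_mono simp: F_fun_eq)
  ultimately show ?thesis by (simp add: isCont_cong)
qed

text \<open>
  The layer thickness \<open>\<eta> = \<epsilon> * ln (1 + \<delta>)\<close> makes the rounding from \<open>i\<close> to \<open>i + 1\<close> cost at most \<open>\<epsilon>\<close> in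
  the ratio at every level, because the denominator is at least \<open>ln (1 + \<delta>)\<close>.
\<close>
lemma limsup_bracketing_number_le_add:
  assumes \<delta>: "0 < \<delta>" "\<delta> < 1" and \<epsilon>: "\<epsilon> > 0"
  shows "limsup (\<lambda>d. ereal (real (bracketing_number d \<delta>) powr (1 / real d)))
    \<le> ereal (F_fun (A_const \<delta> + \<epsilon>))"
proof -
  define t where "t = A_const \<delta> + \<epsilon>"
  define \<eta> where "\<eta> = \<epsilon> * ln (1 + \<delta>)"
  define m where "m = nat \<lceil>2 * ln (1 / \<delta>) / \<eta>\<rceil>"
  have t: "t \<ge> 1" using A_const_ge_1[OF \<delta>] \<epsilon> by (simp add: t_def)
  have F: "F_fun t > 0" using t by (simp add: F_fun_eq)
  have \<eta>: "\<eta> > 0" using \<delta> \<epsilon> by (simp add: \<eta>_def)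
  have "2 * ln (1 / \<delta>) / \<eta> \<le> real m" unfolding m_def by linarith
  then have m: "2 * ln (1 / \<delta>) \<le> real m * \<eta>" using \<eta> by (simp add: field_simps)
  have step: "(real i + 1) * \<eta> \<le> t * ln (1 + \<delta> * exp (real i * \<eta>))" for i :: nat
  proof -
    define w where "w = ln (1 + \<delta> * exp (real i * \<eta>))"
    have w: "w > 0" unfolding w_def using \<delta> by (intro ln_gt_zero) simp
    have "real i * \<eta> / w \<le> A_const \<delta>"
      unfolding w_def using \<eta> by (intro A_const_ge \<delta>) simp
    then have "real i * \<eta> \<le> A_const \<delta> * w" using w by (simp add: divide_simps)
    moreover have "\<eta> \<le> \<epsilon> * w"
      unfolding \<eta>_def w_def using \<delta> \<epsilon> \<eta> by (intro mult_left_mono ln_mono) auto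
    ultimately show ?thesis unfolding t_def w_def[symmetric] by (simp add: distrib_right)
  qed
  have lim: "(\<lambda>d. ereal ((real m + 1) powr (1 / real d) * F_fun t)) \<longlonglongrightarrow> ereal (F_fun t)"
  proof -
    have "(\<lambda>d. (real m + 1) powr (1 / real d) * F_fun t) \<longlonglongrightarrow> (real m + 1) powr 0 * F_fun t"
      by (intro tendsto_intros lim_1_over_n) auto
    then show ?thesis by simp
  qed
  have "limsup (\<lambda>d. ereal (real (bracketing_number d \<delta>) powr (1 / real d)))
      \<le> limsup (\<lambda>d. ereal ((real m + 1) powr (1 / real d) * F_fun t))"
  proof (rule Limsup_mono, rule eventually_mono[OF eventually_gt_at_top[of 0]])
    fix d :: nat assume d: "d > 0"
    have "real (bracketing_number d \<delta>) powr (1 / real d)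
        \<le> ((real m + 1) * F_fun t ^ d) powr (1 / real d)"
      using bracketing_number_upper[OF \<delta> \<eta> m t step d] by (intro powr_mono2) auto
    also have "\<dots> = (real m + 1) powr (1 / real d) * F_fun t"
      using F d by (simp add: powr_mult power_powr_inverse)
    finally show "ereal (real (bracketing_number d \<delta>) powr (1 / real d))
        \<le> ereal ((real m + 1) powr (1 / real d) * F_fun t)" by simp
  qed
  also have "\<dots> = ereal (F_fun t)"
    by (rule lim_imp_Limsup[OF _ lim]) simp
  finally show ?thesis by (simp add: t_def)
qed

lemma limsup_bracketing_number_le:
  assumes \<delta>: "0 < \<delta>" "\<delta> < 1"
  shows "limsup (\<lambda>d. ereal (real (bracketing_number d \<delta>) powr (1 / real d)))
    \<le> ereal (F_fun (A_const \<delta>))"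
proof (rule tendsto_lowerbound)
  have "isCont F_fun (A_const \<delta>)"
    using A_const_ge_1[OF \<delta>] by (intro continuous_F_fun) simp
  moreover have "((\<lambda>\<epsilon>. A_const \<delta> + \<epsilon>) \<longlongrightarrow> A_const \<delta> + 0) (at_right 0)"
    by (intro tendsto_intros)
  ultimately have "((\<lambda>\<epsilon>. F_fun (A_const \<delta> + \<epsilon>)) \<longlongrightarrow> F_fun (A_const \<delta>)) (at_right 0)"
    using isCont_tendsto_compose by fastforce
  then show "((\<lambda>\<epsilon>. ereal (F_fun (A_const \<delta> + \<epsilon>))) \<longlongrightarrow> ereal (F_fun (A_const \<delta>))) (at_right 0)"
    by simp
  show "eventually (\<lambda>\<epsilon>. limsup (\<lambda>d. ereal (real (bracketing_number d \<delta>) powr (1 / real d)))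
      \<le> ereal (F_fun (A_const \<delta> + \<epsilon>))) (at_right 0)"
    using eventually_at_right_less[of 0]
    by (rule eventually_mono) (rule limsup_bracketing_number_le_add[OF \<delta>])
qed simp

section \<open>Asymptotics as \<delta> tends to zero\<close>

lemma F_fun_at_top: "(\<lambda>t. F_fun t - exp 1 * (t + 1/2)) \<in> O(\<lambda>t. 1 / t)"
proof -
  have "(\<lambda>t::real. (1 + t) * exp (t * ln (1 + 1/t) - 1) - (t + 1/2)) \<in> O(\<lambda>t. 1/t)"
    by real_asymp
  then have "(\<lambda>t::real. exp 1 * ((1 + t) * exp (t * ln (1 + 1/t) - 1) - (t + 1/2))) \<in> O(\<lambda>t. 1/t)"
    by simp
  also have "?this \<longleftrightarrow> ?thesis"
  proof (intro landau_o.big.in_cong eventually_mono[OF eventually_gt_at_top[of 0]])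
    fix t :: real assume "t > 0"
    then show "exp 1 * ((1 + t) * exp (t * ln (1 + 1/t) - 1) - (t + 1/2)) = F_fun t - exp 1 * (t + 1/2)"
      by (simp add: F_fun_eq exp_diff right_diff_distrib)
  qed
  finally show ?thesis .
qed

lemma ln_one_plus_ge:
  assumes "(0::real) \<le> u"
  shows "2 * u / (2 + u) \<le> ln (1 + u)"
proof -
  define f where "f u = ln (1 + u) - 2 * u / (2 + u)" for u :: real
  have "f 0 \<le> f u"
  proof (rule DERIV_nonneg_imp_nondecreasing[OF assms])
    fix x :: real assume x: "0 \<le> x" "x \<le> u"
    have "(f has_real_derivative 1 / (1 + x) - 4 / (2 + x)\<^sup>2) (at x)"
      unfolding f_def using x by (auto intro!: derivative_eq_intros simp: field_simps power2_eq_square)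
    moreover have "4 / (2 + x)\<^sup>2 \<le> 1 / (1 + x)"
    proof -
      have "4 * (1 + x) \<le> (2 + x)\<^sup>2" by (simp add: power2_eq_square algebra_simps)
      then show ?thesis using x by (simp add: divide_simps)
    qed
    ultimately show "\<exists>y. (f has_real_derivative y) (at x) \<and> 0 \<le> y" by force
  qed
  then show ?thesis by (simp add: f_def)
qed

text \<open>
  Put \<open>u = y * exp (L - 1)\<close>. Since \<open>1 / ln (1 + u) \<le> 1 / u + 1 / 2\<close>, the ratio is at most
  \<open>L * exp (1 - L) / y + L / 2\<close>. The first term has its maximum \<open>1 / y\<close> at \<open>L = 1\<close> and falls off
  quadratically there with a factor of order \<open>1 / y\<close>, so the linear second term can gain only \<open>O(y)\<close>
  by moving to the right of \<open>1\<close>. For \<open>L > 3\<close> the ratio is at most \<open>1 / y\<close> by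
  cruder estimates: if \<open>u \<le> 1\<close>, the second term is at most half of the first, which has decayed
  enough by then; if \<open>u > 1\<close>, the ratio is only logarithmic in \<open>1 / y\<close>.
\<close>
lemma level_ratio_le:
  fixes y L :: real
  assumes y: "0 < y" and y1: "y \<le> 1" and y_large: "1 + ln (exp 1 / y) / ln 2 \<le> 1 / y" and L: "0 \<le> L"
  shows "L / ln (1 + y * exp (L - 1)) \<le> 1 / y + 1 / 2 + y"
proof -
  define u where "u = y * exp (L - 1)"
  have u: "u > 0" using y by (simp add: u_def)
  have lnu: "ln (1 + u) > 0" using u by simp
  have inv: "1 / ln (1 + u) \<le> 1 / u + 1 / 2"
  proof -
    have "1 / ln (1 + u) \<le> 1 / (2 * u / (2 + u))"
      using u ln_one_plus_ge[of u] by (intro divide_left_mono mult_pos_pos lnu) auto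
    also have "\<dots> = 1 / u + 1 / 2" using u by (simp add: field_simps)
    finally show ?thesis .
  qed
  have ratio: "L / ln (1 + u) \<le> L / u + L / 2"
    using mult_left_mono[OF inv L] by (simp add: distrib_left)
  have Lu: "L / u = L * exp (1 - L) / y"
    using y by (simp add: u_def exp_diff divide_simps)
  have "L * exp (1 - L) \<le> 1"
    using exp_ge_add_one_self[of "L - 1"] by (simp add: exp_diff divide_simps)
  consider "L \<le> 1" | "1 < L" "L \<le> 3" | "3 < L" "u \<le> 1" | "3 < L" "1 < u" by linarith
  then have "L / ln (1 + u) \<le> 1 / y + 1 / 2 + y"
  proof cases
    case 1
    have "L * exp (1 - L) / y \<le> 1 / y"
      using \<open>L * exp (1 - L) \<le> 1\<close> y by (intro divide_right_mono) auto
    then show ?thesis using ratio Lu 1 y by linarith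
  next
    case 2
    define x where "x = L - 1"
    have x: "0 < x" "x \<le> 2" using 2 by (auto simp: x_def)
    have "L * exp (1 - L) \<le> 1 - x\<^sup>2 / 10"
    proof -
      have "x\<^sup>2 \<le> 4" using power_mono[of x 2 2] x by simp
      then have "(x\<^sup>2 / 10) * (1 + x + x\<^sup>2 / 2) \<le> (x\<^sup>2 / 10) * 5"
        using x by (intro mult_left_mono) auto
      moreover have "(1 - x\<^sup>2 / 10) * (1 + x + x\<^sup>2 / 2)
          = 1 + x + x\<^sup>2 / 2 - (x\<^sup>2 / 10) * (1 + x + x\<^sup>2 / 2)"
        unfolding left_diff_distrib by simp
      ultimately have "1 + x \<le> (1 - x\<^sup>2 / 10) * (1 + x + x\<^sup>2 / 2)" by linarith
      also have "\<dots> \<le> (1 - x\<^sup>2 / 10) * exp x"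
        using x \<open>x\<^sup>2 \<le> 4\<close> by (intro mult_left_mono exp_lower_Taylor_quadratic) auto
      finally have "(1 + x) / exp x \<le> 1 - x\<^sup>2 / 10" by (simp add: divide_simps)
      moreover have "L * exp (1 - L) = (1 + x) / exp x" by (simp add: x_def exp_diff)
      ultimately show ?thesis by simp
    qed
    then have "L / u \<le> (1 - x\<^sup>2 / 10) / y" unfolding Lu using y by (intro divide_right_mono) auto
    also have "(1 - x\<^sup>2 / 10) / y = 1 / y - x\<^sup>2 / (10 * y)" by (simp add: diff_divide_distrib)
    finally have "L / ln (1 + u) \<le> 1 / y - x\<^sup>2 / (10 * y) + (1 + x) / 2"
      using ratio by (simp add: x_def)
    moreover have "x / 2 \<le> x\<^sup>2 / (10 * y) + y"
    proof -
      \<comment> \<open>the discriminant of \<open>x\<^sup>2 - 5 * x * y + 10 * y\<^sup>2\<close> is negative\<close>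
      have "0 \<le> (x - 5 / 2 * y)\<^sup>2 + 15 / 4 * y\<^sup>2" by simp
      then have "x * 5 * y \<le> x\<^sup>2 + 10 * y\<^sup>2" by (simp add: power2_eq_square algebra_simps)
      then show ?thesis using y by (simp add: divide_simps power2_eq_square algebra_simps)
    qed
    ultimately show ?thesis by (simp add: add_divide_distrib)
  next
    case 3
    have "1 / 2 \<le> 1 / 2 / u" using 3 u by (simp add: divide_simps)
    then have "1 / ln (1 + u) \<le> 3 / 2 / u" using inv by simp
    from mult_left_mono[OF this L] have "L / ln (1 + u) \<le> 3 / 2 * (L / u)"
      by (simp add: mult.commute)
    also have "\<dots> = 3 / 2 * (L * exp (1 - L)) / y" unfolding Lu by simp
    also have "\<dots> \<le> 1 / y"
    proof (intro divide_right_mono)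
      have "0 \<le> (L - 3) * (L - 1)" using 3 by (intro mult_nonneg_nonneg) auto
      then have "3 / 2 * L \<le> 1 + (L - 1) + (L - 1)\<^sup>2 / 2"
        using 3 by (simp add: power2_eq_square algebra_simps)
      also have "\<dots> \<le> exp (L - 1)" using 3 by (intro exp_lower_Taylor_quadratic) auto
      finally show "3 / 2 * (L * exp (1 - L)) \<le> 1"
        by (simp add: exp_diff divide_simps)
    qed (use y in auto)
    also have "\<dots> \<le> 1 / y + 1 / 2 + y" using y by simp
    finally show ?thesis .
  next
    case 4
    have "L = ln u + ln (exp 1 / y)"
      using y u by (simp add: u_def ln_mult ln_div)
    then have "L / ln (1 + u) = ln u / ln (1 + u) + ln (exp 1 / y) / ln (1 + u)"
      by (simp add: add_divide_distrib)
    moreover have "ln u / ln (1 + u) \<le> 1" using u lnu by (simp add: divide_simps)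
    moreover have "ln (exp 1 / y) / ln (1 + u) \<le> ln (exp 1 / y) / ln 2"
      using 4 y y1 ln_le_minus_one[OF y] by (intro frac_le) (auto simp: ln_div)
    ultimately show ?thesis using y y_large by linarith
  qed
  then show ?thesis by (simp add: u_def)
qed

lemma A_const_asymp:
  "(\<lambda>\<delta>. A_const \<delta> - (1 / (exp 1 * \<delta>) + 1 / 2)) \<in> O[at_right 0](\<lambda>\<delta>. \<delta>)"
proof -
  define c where "c y = 1 / y + 1 / 2" for y :: real
  have scale: "filterlim (\<lambda>\<delta>::real. exp 1 * \<delta>) (at_right 0) (at_right 0)"
    by real_asymp
  have "(\<lambda>y::real. 1 / ln (1 + y) - c y) \<in> O[at_right 0](\<lambda>y. y)"
    unfolding c_def by real_asymp
  then have "(\<lambda>y::real. \<bar>1 / ln (1 + y) - c y\<bar> + y) \<in> O[at_right 0](\<lambda>y. y)"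
    by (intro sum_in_bigo) auto
  from landau_o.big.compose[OF this scale]
  have bound: "(\<lambda>\<delta>. \<bar>1 / ln (1 + exp 1 * \<delta>) - c (exp 1 * \<delta>)\<bar> + exp 1 * \<delta>) \<in> O[at_right 0](\<lambda>\<delta>. \<delta>)"
    by simp
  have "eventually (\<lambda>y::real. 0 < y \<and> y \<le> 1 \<and> 1 + ln (exp 1 / y) / ln 2 \<le> 1 / y) (at_right 0)"
    by (intro eventually_conj; real_asymp)
  then have "eventually (\<lambda>\<delta>::real. 0 < exp 1 * \<delta> \<and> exp 1 * \<delta> \<le> 1 \<and>
      1 + ln (exp 1 / (exp 1 * \<delta>)) / ln 2 \<le> 1 / (exp 1 * \<delta>)) (at_right 0)"
    by (rule eventually_compose_filterlim[OF _ scale])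
  then have "eventually (\<lambda>\<delta>. norm (A_const \<delta> - c (exp 1 * \<delta>))
      \<le> norm (\<bar>1 / ln (1 + exp 1 * \<delta>) - c (exp 1 * \<delta>)\<bar> + exp 1 * \<delta>)) (at_right 0)"
  proof eventually_elim
    case (elim \<delta>)
    define y where "y = exp 1 * \<delta>"
    have y: "0 < y" "y \<le> 1" "1 + ln (exp 1 / y) / ln 2 \<le> 1 / y" using elim by (auto simp: y_def)
    have \<delta>: "0 < \<delta>" using elim by (simp add: zero_less_mult_iff)
    have "exp 1 > (1::real)" by simp
    then have "\<delta> < y" using \<delta> by (simp add: y_def)
    then have \<delta>1: "\<delta> < 1" using y by simp
    have eq: "\<delta> * exp L = y * exp (L - 1)" for L by (simp add: y_def exp_diff)
    have "A_const \<delta> \<le> c y + y"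
      unfolding A_const_def eq c_def using level_ratio_le[OF y] by (intro cSUP_least) auto
    moreover have "1 / ln (1 + y) \<le> A_const \<delta>"
      using A_const_ge[OF \<delta> \<delta>1, of 1] by (simp add: y_def mult.commute)
    ultimately show ?case using y unfolding y_def[symmetric] real_norm_def by linarith
  qed
  from landau_o.big_mono[OF this] bound show ?thesis
    unfolding c_def by (rule landau_o.big.trans)
qed

lemma F_fun_A_const_asymp:
  "(\<lambda>\<delta>. F_fun (A_const \<delta>) - (1 / \<delta> + exp 1)) \<in> O[at_right 0](\<lambda>\<delta>. \<delta>)"
proof -
  have small: "eventually (\<lambda>\<delta>::real. 0 < \<delta> \<and> \<delta> < 1) (at_right 0)"
    by (intro eventually_conj; real_asymp)
  have ge: "eventually (\<lambda>\<delta>. 1 / ln (1 + exp 1 * \<delta>) \<le> A_const \<delta>) (at_right 0)"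
    using small
  proof eventually_elim
    case (elim \<delta>)
    then show ?case using A_const_ge[of \<delta> 1] by (simp add: mult.commute)
  qed
  have "filterlim (\<lambda>\<delta>::real. 1 / ln (1 + exp 1 * \<delta>)) at_top (at_right 0)"
    by real_asymp
  then have lim: "filterlim A_const at_top (at_right 0)"
    using ge by (rule filterlim_at_top_mono)
  have "eventually (\<lambda>\<delta>. norm (1 / A_const \<delta>) \<le> norm (exp 1 * \<delta>)) (at_right 0)"
    using ge small
  proof eventually_elim
    case (elim \<delta>)
    have ln: "0 < ln (1 + exp 1 * \<delta>)" using elim by (intro ln_gt_zero) simp
    then have "1 / A_const \<delta> \<le> 1 / (1 / ln (1 + exp 1 * \<delta>))"
      using elim by (intro divide_left_mono mult_pos_pos) (auto intro: less_le_trans[OF _ elim(1)])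
    also have "\<dots> \<le> exp 1 * \<delta>" using ln_add_one_self_le_self[of "exp 1 * \<delta>"] elim by simp
    finally show ?case using elim A_const_ge_1[of \<delta>] by simp
  qed
  from landau_o.big_mono[OF this]
  have inv: "(\<lambda>\<delta>. 1 / A_const \<delta>) \<in> O[at_right 0](\<lambda>\<delta>. \<delta>)" by simp
  have "(\<lambda>\<delta>. F_fun (A_const \<delta>) - exp 1 * (A_const \<delta> + 1 / 2)) \<in> O[at_right 0](\<lambda>\<delta>. \<delta>)"
    using landau_o.big.compose[OF F_fun_at_top lim] inv by (rule landau_o.big.trans)
  moreover have "(\<lambda>\<delta>. exp 1 * (A_const \<delta> - (1 / (exp 1 * \<delta>) + 1 / 2))) \<in> O[at_right 0](\<lambda>\<delta>. \<delta>)"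
    using A_const_asymp by simp
  ultimately have "(\<lambda>\<delta>. (F_fun (A_const \<delta>) - exp 1 * (A_const \<delta> + 1 / 2))
      + exp 1 * (A_const \<delta> - (1 / (exp 1 * \<delta>) + 1 / 2))) \<in> O[at_right 0](\<lambda>\<delta>. \<delta>)"
    by (rule sum_in_bigo)
  also have "?this \<longleftrightarrow> ?thesis"
    using small by (intro landau_o.big.in_cong) (auto elim!: eventually_mono simp: field_simps)
  finally show ?thesis .
qed

theorem mainTheorem5:
  shows "(\<forall>\<delta>::real. 0 < \<delta> \<and> \<delta> < 1 \<longrightarrow>
            ereal (1 / \<delta>)
              \<le> liminf (\<lambda>d. ereal (real (bracketing_number d \<delta>) powr (1 / real d)))
          \<and> liminf (\<lambda>d. ereal (real (bracketing_number d \<delta>) powr (1 / real d)))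
              \<le> limsup (\<lambda>d. ereal (real (bracketing_number d \<delta>) powr (1 / real d)))
          \<and> limsup (\<lambda>d. ereal (real (bracketing_number d \<delta>) powr (1 / real d)))
              \<le> ereal (F_fun (A_const \<delta>)))
       \<and> (\<lambda>\<delta>::real. F_fun (A_const \<delta>) - (1 / \<delta> + exp 1)) \<in> O[at_right 0](\<lambda>\<delta>. \<delta>)"
  by (intro conjI allI impI)
    (auto simp: liminf_bracketing_number_ge limsup_bracketing_number_le Liminf_le_Limsup
      intro: F_fun_A_const_asymp)

end
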